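(* Fix an integer $r>1$ and let $f_r$ be the Newman–Conway sequence: $f_r(i)=1$ for $1\le i\le r+1$ and $f_r(n)=f_r(n-f_r(n-1))+f_r(f_r(n-1))$ for $n> r+1$. Define $M_1(n)=1$ for $1\le n\le r+1$ and $M_1(n)=M_1(n-f_r(n-1))+1$ for $n>r+1$, and let $\alpha_1(g)=\min\{n : M_1(n)=g\}$. Let $E_i=1$ for $1\le i\le r$ and $E_n=E_{n-1}+E_{n-r}$ for $n>r$. Then for every $g>1$, $\alpha_1(g)=E_{2r+g-2}+1$.
   Context: $M_1$ is the maternal generation sequence of $f_r$, i.e. the generation sequence based on the spot function $S_1(n)=n-f_r(n-1)$, with the same number $r+1$ of initial conditions as $f_r$; $\alpha_1(g)$ is the start of the $g$-th maternal generation. *)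

theory Defs
  imports Main
begin

text \<open>All sequences are indexed from 1; their values at index 0 are irrelevant.\<close>

function newman_conway :: "nat \<Rightarrow> nat \<Rightarrow> nat" where
  "newman_conway r n =
    (if n \<le> r + 1 then 1
     else newman_conway r (n - newman_conway r (n - 1))
        + newman_conway r (newman_conway r (n - 1)))"
  by pat_completeness auto

text \<open>Well-definedness of the nested recursion: the inner value lies between 1 and \<open>n - 1\<close>.\<close>

lemma newman_conway_bounds_partial:
  "newman_conway_dom (r, n) \<Longrightarrow> 1 \<le> n \<Longrightarrow>
    1 \<le> newman_conway r n \<and> newman_conway r n \<le> n"
proof (induction r n rule: newman_conway.pinduct)
  case (1 r n)
  show ?case
  proof (cases "n \<le> r + 1")
    case True
    then show ?thesis using "1.prems" by (subst (1 2) newman_conway.psimps[OF "1.hyps"]) simp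
  next
    case False
    let ?k = "newman_conway r (n - 1)"
    have k: "1 \<le> ?k" "?k \<le> n - 1" using "1.IH"(1)[OF False] False by simp_all
    then have "1 \<le> newman_conway r (n - ?k)" "newman_conway r (n - ?k) \<le> n - ?k"
      using "1.IH"(2)[OF False] by simp_all
    moreover have "newman_conway r ?k \<le> ?k"
      using "1.IH"(4)[OF False] k by simp
    moreover have "newman_conway r n = newman_conway r (n - ?k) + newman_conway r ?k"
      using newman_conway.psimps[OF "1.hyps"] False by (simp only: if_False)
    ultimately show ?thesis using k by linarith
  qed
qed

lemma newman_conway_total: "All newman_conway_dom"
proof (rule newman_conway.termination[of "measure snd"])
  fix r n :: nat
  assume n: "\<not> n \<le> r + 1" and d: "newman_conway_dom (r, n - 1)"
  have b: "1 \<le> newman_conway r (n - 1)" "newman_conway r (n - 1) \<le> n - 1"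
    using newman_conway_bounds_partial[OF d] n by simp_all
  then have "n - newman_conway r (n - 1) < n" "newman_conway r (n - 1) < n"
    using n by linarith+
  then show "((r, n - newman_conway r (n - 1)), (r, n)) \<in> measure snd"
    "((r, newman_conway r (n - 1)), (r, n)) \<in> measure snd"
    by (simp_all only: in_measure snd_conv)
qed auto

termination newman_conway
  by (rule newman_conway_total)

declare newman_conway.simps [simp del]

lemma newman_conway_bounds:
  "1 \<le> n \<Longrightarrow> 1 \<le> newman_conway r n \<and> newman_conway r n \<le> n"
  by (rule newman_conway_bounds_partial[OF newman_conway_total[rule_format]])

function maternal_gen :: "nat \<Rightarrow> nat \<Rightarrow> nat" where
  "maternal_gen r n =
    (if n \<le> r + 1 then 1 else maternal_gen r (n - newman_conway r (n - 1)) + 1)"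
  by pat_completeness auto

termination maternal_gen
proof (relation "measure snd")
  fix r n :: nat
  assume n: "\<not> n \<le> r + 1"
  then have "1 \<le> newman_conway r (n - 1)"
    using newman_conway_bounds[of "n - 1" r] by simp
  then have "n - newman_conway r (n - 1) < n"
    using n by linarith
  then show "((r, n - newman_conway r (n - 1)), (r, n)) \<in> measure snd"
    by (simp only: in_measure snd_conv)
qed auto

declare maternal_gen.simps [simp del]

definition maternal_gen_start :: "nat \<Rightarrow> nat \<Rightarrow> nat" where
  "maternal_gen_start r g = (LEAST n. 1 \<le> n \<and> maternal_gen r n = g)"

text \<open>The disjunct \<open>r = 0\<close> only makes the recursion total; the sequence is meant for \<open>r \<ge> 1\<close>.\<close>

function E_seq :: "nat \<Rightarrow> nat \<Rightarrow> nat" where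
  "E_seq r n = (if r = 0 \<or> n \<le> r then 1 else E_seq r (n - 1) + E_seq r (n - r))"
  by pat_completeness auto

termination E_seq
  by (relation "measure snd") auto

declare E_seq.simps [simp del]

end

theory Submission imports Defs
begin

text \<open>
  Write \<open>f\<close> for the Newman--Conway sequence and \<open>E\<close> for \<open>E_seq r\<close>. The sequence \<open>f\<close> grows by steps of
  0 or 1, so the same is true of the spot function \<open>S n = n - f (n - 1)\<close>, and the maternal generation
  sequence is nondecreasing. The key fact is \<open>f (E m - 1) = f (E m) = E (m - r)\<close> for \<open>m > r\<close>; it yields
  \<open>S (E m) = E (m - 1)\<close> and \<open>S (E m + 1) = E (m - 1) + 1\<close>, so each generation boundary \<open>E m | E m + 1\<close>
  is mapped to the previous one.
\<close>

lemma newman_conway_initial: "n \<le> r + 1 \<Longrightarrow> newman_conway r n = 1"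
  by (simp add: newman_conway.simps)

lemma newman_conway_rec:
  "r + 1 < n \<Longrightarrow> newman_conway r n =
    newman_conway r (n - newman_conway r (n - 1)) + newman_conway r (newman_conway r (n - 1))"
  by (subst newman_conway.simps) simp

lemma newman_conway_pos: "1 \<le> newman_conway r n"
  using newman_conway_initial[of n r] newman_conway_bounds[of n r] by (cases "n = 0") auto

text \<open>Beyond the initial values, passing from \<open>n\<close> to \<open>Suc n\<close> moves
  exactly one of the two arguments of the recursion, and moves it by 1: the first if
  \<open>f n = f (n - 1)\<close>, the second otherwise. The increment is therefore one that already
  occurs at a smaller index.\<close>

lemma newman_conway_slow:
  "newman_conway r n \<le> newman_conway r (Suc n) \<and>
   newman_conway r (Suc n) \<le> Suc (newman_conway r n)"
proof (induction n rule: less_induct)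
  case (less n)
  let ?f = "newman_conway r"
  consider "n < r + 1" | "n = r + 1" | "n > r + 1" by linarith
  then show ?case
  proof cases
    case 1
    then show ?thesis by (simp add: newman_conway_initial)
  next
    case 2
    then show ?thesis by (simp add: newman_conway_initial newman_conway_rec)
  next
    case 3
    define k where "k = ?f (n - 1)"
    have k: "1 \<le> k" "k \<le> n - 1"
      using newman_conway_bounds[of "n - 1" r] 3 by (auto simp: k_def)
    have fn: "?f n = ?f (n - k) + ?f k"
      using newman_conway_rec[OF 3] by (simp add: k_def)
    have fSn: "?f (Suc n) = ?f (Suc n - ?f n) + ?f (?f n)"
      using newman_conway_rec[of r "Suc n"] 3 by simp
    have "?f n = k \<or> ?f n = Suc k"
      using less.IH[of "n - 1"] 3 by (auto simp: k_def)
    then show ?thesis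
    proof
      assume "?f n = k"
      then show ?thesis
        using fSn fn less.IH[of "n - k"] k by (simp add: Suc_diff_le)
    next
      assume "?f n = Suc k"
      moreover have "k < n" using k by linarith
      ultimately show ?thesis
        using fSn fn less.IH[of k] by simp
    qed
  qed
qed

lemma newman_conway_mono: "m \<le> n \<Longrightarrow> newman_conway r m \<le> newman_conway r n"
  by (rule lift_Suc_mono_le) (use newman_conway_slow in auto)

lemma spot_mono:
  "m \<le> n \<Longrightarrow> Suc m - newman_conway r m \<le> Suc n - newman_conway r n"
proof (rule lift_Suc_mono_le[of "\<lambda>n. Suc n - newman_conway r n"])
  fix n
  show "Suc n - newman_conway r n \<le> Suc (Suc n) - newman_conway r (Suc n)"
    using newman_conway_slow[of r n] by linarith
qed

lemma E_seq_initial: "n \<le> r \<Longrightarrow> E_seq r n = 1"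
  by (simp add: E_seq.simps)

lemma E_seq_rec: "0 < r \<Longrightarrow> r < n \<Longrightarrow> E_seq r n = E_seq r (n - 1) + E_seq r (n - r)"
  by (subst E_seq.simps) simp

lemma E_seq_pos: "1 \<le> E_seq r n"
  by (induction r n rule: E_seq.induct) (subst E_seq.simps, auto)

lemma E_seq_mono: "m \<le> n \<Longrightarrow> E_seq r m \<le> E_seq r n"
proof (rule lift_Suc_mono_le[of "E_seq r"])
  fix n
  show "E_seq r n \<le> E_seq r (Suc n)"
    by (subst (2) E_seq.simps) (use E_seq_initial[of n r] in \<open>auto simp: E_seq.simps[of 0]\<close>)
qed

text \<open>In this range the summand \<open>E (n - r)\<close> is still 1. The case
  \<open>i = r\<close> gives \<open>E (2 * r) = r + 1\<close>, the last initial index of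
  \<open>f\<close>.\<close>

lemma E_seq_linear: "0 < r \<Longrightarrow> i \<le> r \<Longrightarrow> E_seq r (r + i) = i + 1"
  by (induction i) (simp_all add: E_seq_initial E_seq_rec)

text \<open>\<open>f\<close> is bounded above by \<open>E (m - r)\<close> up to index
  \<open>E m\<close>, and below by the same value from \<open>E m - 1\<close> on. Both indices enter
  the induction: the upper bound uses the value at \<open>E (m - r)\<close>, the lower bound the one
  at \<open>E (m - r) - 1\<close>.\<close>

lemma newman_conway_at_E_seq:
  assumes "0 < r" "r < m"
  shows "newman_conway r (E_seq r m - 1) = E_seq r (m - r)
    \<and> newman_conway r (E_seq r m) = E_seq r (m - r)"
  using assms(2)
proof (induction m rule: less_induct)
  case (less m)
  let ?f = "newman_conway r" and ?E = "E_seq r"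
  show ?case
  proof (cases "m \<le> 2 * r")
    case True
    then have "?E m \<le> r + 1" "?E (m - r) = 1"
      using E_seq_linear[of r "m - r"] assms(1) less.prems by (simp_all add: E_seq_initial)
    then show ?thesis by (simp add: newman_conway_initial)
  next
    case False
    have rec1: "?E m = ?E (m - 1) + ?E (m - r)"
      using less.prems assms(1) by (simp add: E_seq_rec)
    have comm: "m - 1 - r = m - r - 1" by simp
    have rec2: "?E (m - r) = ?E (m - r - 1) + ?E (m - r - r)"
      using False assms(1) E_seq_rec[of r "m - r"] by simp
    have IH1: "?f (?E (m - 1)) = ?E (m - r - 1)"
      using less.IH[of "m - 1"] False assms(1) comm by auto
    have IH2: "?f (?E (m - r) - 1) = ?E (m - r - r)" "?f (?E (m - r)) = ?E (m - r - r)"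
      using less.IH[of "m - r"] False assms(1) less.prems by auto
    have big: "r + 1 \<le> ?E (m - 1)"
      using E_seq_linear[of r r] E_seq_mono[of "r + r" "m - 1" r] False assms(1) by simp
    \<comment> \<open>If \<open>f x\<close> has reached \<open>E (m - r)\<close>, the first argument
      of the recursion for \<open>Suc x\<close> is at most \<open>E (m - 1)\<close>, so
      \<open>f (Suc x)\<close> is at most
      \<open>E (m - r - 1) + E (m - r - r) = E (m - r)\<close>.\<close>
    have upper: "x \<le> ?E m \<Longrightarrow> ?f x \<le> ?E (m - r)" for x
    proof (induction x)
      case 0
      show ?case using E_seq_pos[of r "m - r"] by (simp add: newman_conway_initial)
    next
      case (Suc x)
      show ?case
      proof (cases "?f x < ?E (m - r)")
        case True
        then show ?thesis using newman_conway_slow[of r x] by linarith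
      next
        case eq: False
        then have fx: "?f x = ?E (m - r)" using Suc by simp
        show ?thesis
        proof (cases "Suc x \<le> r + 1")
          case True
          then show ?thesis using E_seq_pos[of r "m - r"] by (simp add: newman_conway_initial)
        next
          case False
          then have "?f (Suc x) = ?f (Suc x - ?E (m - r)) + ?f (?E (m - r))"
            using newman_conway_rec[of r "Suc x"] fx by simp
          moreover have "?f (Suc x - ?E (m - r)) \<le> ?f (?E (m - 1))"
            using Suc.prems rec1 by (intro newman_conway_mono) linarith
          ultimately show ?thesis using IH1 IH2 rec2 by linarith
        qed
      qed
    qed
    have lower: "?E (m - r) \<le> ?f (?E m - 1)"
    proof (rule ccontr)
      assume contr: "\<not> ?E (m - r) \<le> ?f (?E m - 1)"
      \<comment> \<open>Otherwise \<open>f\<close> would have to drop by 1 at every step to the left of \<open>E m - 1\<close>.\<close>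
      have "j < ?E (m - r) \<Longrightarrow> ?f (?E m - 1 - j) + j < ?E (m - r)" for j
      proof (induction j)
        case 0
        show ?case using contr by simp
      next
        case (Suc j)
        define y where "y = ?E m - 1 - j"
        define k where "k = ?f (y - 1)"
        have fy: "?f y + j < ?E (m - r)" using Suc by (simp add: y_def)
        have y: "r + 1 < y" using Suc.prems rec1 big by (simp add: y_def)
        have "k \<le> ?f y" unfolding k_def by (rule newman_conway_mono) simp
        then have k: "k + j < ?E (m - r)" using fy by simp
        have "?E (m - 1) \<le> y - k" using k rec1 by (simp add: y_def)
        then have "?E (m - r - 1) \<le> ?f (y - k)"
          using newman_conway_mono IH1 by metis
        \<comment> \<open>The spot function is monotone and takes the value
          \<open>E (m - r - 1)\<close> at \<open>E (m - r)\<close>. This bounds \<open>f k\<close>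
          from below, so that \<open>f y\<close> exceeds \<open>k = f (y - 1)\<close>.\<close>
        moreover have "Suc k - ?f k \<le> ?E (m - r - 1)"
        proof -
          have "k \<le> ?E (m - r) - 1" using k by simp
          then have "Suc k - ?f k \<le> Suc (?E (m - r) - 1) - ?E (m - r - r)"
            using spot_mono[of k "?E (m - r) - 1" r] by (simp only: IH2)
          then show ?thesis using k rec2 by simp
        qed
        moreover have "?f y = ?f (y - k) + ?f k"
          using newman_conway_rec[OF y] by (simp add: k_def)
        ultimately have "k < ?f y" by linarith
        moreover have "?E m - 1 - Suc j = y - 1" by (simp add: y_def)
        ultimately show ?case using fy k_def by simp
      qed
      \<comment> \<open>After this many drops the value of \<open>f\<close> would be 0.\<close>
      from this[of "?E (m - r) - 1"] show False
        using newman_conway_pos[of r "?E m - 1 - (?E (m - r) - 1)"] E_seq_pos[of r "m - r"]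
        by linarith
    qed
    show ?thesis
      using lower upper[of "?E m"] newman_conway_mono[of "?E m - 1" "?E m" r] by simp
  qed
qed

lemma maternal_gen_initial: "n \<le> r + 1 \<Longrightarrow> maternal_gen r n = 1"
  by (simp add: maternal_gen.simps)

lemma maternal_gen_rec:
  "r + 1 < n \<Longrightarrow> maternal_gen r n = maternal_gen r (n - newman_conway r (n - 1)) + 1"
  by (subst maternal_gen.simps) simp

text \<open>The spots of \<open>n\<close> and \<open>Suc n\<close> are equal or adjacent, so the
  comparison reduces to a smaller index.\<close>

lemma maternal_gen_mono: "m \<le> n \<Longrightarrow> maternal_gen r m \<le> maternal_gen r n"
proof (rule lift_Suc_mono_le[of "maternal_gen r"])
  fix n
  show "maternal_gen r n \<le> maternal_gen r (Suc n)"
  proof (induction n rule: less_induct)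
    case (less n)
    consider "n < r + 1" | "n = r + 1" | "n > r + 1" by linarith
    then show ?case
    proof cases
      case 1
      then show ?thesis by (simp add: maternal_gen_initial)
    next
      case 2
      then show ?thesis by (simp add: maternal_gen_initial maternal_gen_rec)
    next
      case 3
      define s where "s = n - newman_conway r (n - 1)"
      have "s < n" using newman_conway_pos[of r "n - 1"] 3 by (simp add: s_def)
      have "Suc n - newman_conway r n = s \<or> Suc n - newman_conway r n = Suc s"
        using newman_conway_slow[of r "n - 1"] newman_conway_bounds[of "n - 1" r] 3
        by (auto simp: s_def)
      then show ?thesis
        using less.IH[OF \<open>s < n\<close>] maternal_gen_rec[of r n] maternal_gen_rec[of r "Suc n"] 3
        by (auto simp: s_def)
    qed
  qed
qed

text \<open>The two indices are the two sides of a generation boundary, starting from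
  \<open>r + 1\<close> and \<open>r + 2\<close> at \<open>i = 0\<close>. The spot function carries
  each side to the same side of the preceding boundary.\<close>

lemma maternal_gen_at_E_seq:
  assumes "0 < r"
  shows "maternal_gen r (E_seq r (2 * r + i)) = i + 1
    \<and> maternal_gen r (E_seq r (2 * r + i) + 1) = i + 2"
proof (induction i)
  case 0
  then show ?case
    using E_seq_linear[of r r] assms
    by (simp add: maternal_gen_initial maternal_gen_rec newman_conway_initial mult_2)
next
  case (Suc i)
  let ?n = "2 * r + i"
  have rec: "E_seq r (Suc ?n) = E_seq r ?n + E_seq r (Suc ?n - r)"
    using E_seq_rec[of r "Suc ?n"] assms by simp
  have "r + 1 \<le> E_seq r ?n"
    using E_seq_linear[of r r] E_seq_mono[of "r + r" ?n r] assms by simp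
  then have big: "r + 1 < E_seq r (Suc ?n)"
    using rec E_seq_pos[of r "Suc ?n - r"] by linarith
  have nc: "newman_conway r (E_seq r (Suc ?n) - 1) = E_seq r (Suc ?n - r)"
    "newman_conway r (E_seq r (Suc ?n)) = E_seq r (Suc ?n - r)"
    using newman_conway_at_E_seq[of r "Suc ?n"] assms by auto
  have "maternal_gen r (E_seq r (Suc ?n)) = maternal_gen r (E_seq r ?n) + 1"
    using maternal_gen_rec[OF big] nc rec by simp
  moreover have "maternal_gen r (E_seq r (Suc ?n) + 1) = maternal_gen r (E_seq r ?n + 1) + 1"
    using maternal_gen_rec[of r "E_seq r (Suc ?n) + 1"] big nc rec by simp
  ultimately show ?case using Suc by simp
qed

theorem mainTheorem5:
  fixes r g :: nat
  assumes "r > 1" and "g > 1"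
  shows "maternal_gen_start r g = E_seq r (2 * r + g - 2) + 1"
  unfolding maternal_gen_start_def
proof (rule Least_equality)
  let ?e = "E_seq r (2 * r + g - 2)"
  have gen: "maternal_gen r ?e = g - 1" "maternal_gen r (?e + 1) = g"
    using maternal_gen_at_E_seq[of r "g - 2"] assms by auto
  then show "1 \<le> ?e + 1 \<and> maternal_gen r (?e + 1) = g" by simp
  \<comment> \<open>An index up to \<open>?e\<close> has generation at most \<open>g - 1\<close> by
    monotonicity.\<close>
  show "?e + 1 \<le> n" if "1 \<le> n \<and> maternal_gen r n = g" for n
    using maternal_gen_mono[of n ?e r] that gen assms by (cases "n \<le> ?e") auto
qed

end
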